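(* Let $\xi\in\mathbb{F}_N(\mathbb{R}^2)$ be a central configuration of the planar $N$-vortex problem with $\nabla H(\xi)+\omega M_\Gamma\xi=0$, $\omega\in\mathbb{R}\setminus\{0\}$, and let $z(t)=e^{-\omega K t}\xi$ be the relative equilibrium (with angular velocity $\omega$) generated by $\xi$. If $z$ is non-degenerate, then $z$ is spectrally stable if and only if every eigenvalue $\mu\in\mathbb{C}$ of the matrix $M_\Gamma^{-1}D^2H(\xi)$ satisfies one of the following alternatives: - $\mu\in i\mathbb{R}$; - $\mu\in\mathbb{R}$ and $\mu\in[-|\omega|,|\omega|]$. In particular, a relative equilibrium $z$ generated by a central configuration $\xi$ is non-degenerate if and only if $\mu\neq\pm\omega$ for each of the $2N-4$ nontrivial eigenvalues $\mu$ of $M_\Gamma^{-1}D^2H(\xi)$.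
   Context: Let $N\ge 2$ and let $\Gamma_1,\dots,\Gamma_N\in\mathbb{R}\setminus\{0\}$ be circulations (of arbitrary signs) with nonzero total circulation $\sum_i\Gamma_i\neq 0$. Let $J=\begin{bmatrix}0&1\\-1&0\end{bmatrix}$, $K=I_N\otimes J$ (the $2N\times 2N$ block diagonal matrix with $N$ diagonal blocks $J$), and $M_\Gamma=\mathrm{diag}(\Gamma_1,\dots,\Gamma_N)\otimes I_2$. Put $\mathbb{F}_N(\mathbb{R}^2)=\{z=(z_1,\dots,z_N)\in(\mathbb{R}^2)^N: z_i\ne z_j \text{ for } i\neq j\}$ and $H(z)=-\sum_{i<j}\Gamma_i\Gamma_j\log|z_i-z_j|$ on it. A central configuration is $\xi\in\mathbb{F}_N(\mathbb{R}^2)$ such that $\nabla H(\xi)+\omega M_\Gamma\xi=0$ for some $\omega\in\mathbb{R}$. If $\omega\neq0$, $z(t)=e^{-\omega Kt}\xi$ is a periodic solution of $M_\Gamma\dot z=K\nabla H(z)$, called the relative equilibrium generated by $\xi$, with angular velocity $\omega$. $D^2H(\xi)$ denotes the Hessian of $H$ at $\xi$. The stability matrix is $B=K\,[M_\Gamma^{-1}D^2H(\xi)+\omega I_{2N}]$. By the symmetries of the problem, $B$ always has the eigenvalue $0$ (with algebraic multiplicity at least $2$) and the eigenvalues $\pm i\omega$; removing $0,0,i\omega,-i\omega$ from the list of the $2N$ eigenvalues of $B$ (counted with algebraic multiplicity) leaves the $2N-4$ nontrivial eigenvalues of $B$. Correspondingly, $M_\Gamma^{-1}D^2H(\xi)$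 always has the eigenvalues $0,0,\omega,-\omega$, and the remaining $2N-4$ eigenvalues (with algebraic multiplicity) are its nontrivial eigenvalues. The relative equilibrium is non-degenerate if all $2N-4$ nontrivial eigenvalues of $B$ are nonzero. A non-degenerate relative equilibrium is spectrally stable if all nontrivial eigenvalues of $B$ are purely imaginary. *)

theory Defs
  imports "HOL-Analysis.Analysis" "HOL-Computational_Algebra.Computational_Algebra"
begin

section \<open>Matrices\<close>

definition kronecker :: "'a::times^'m^'m \<Rightarrow> 'a^'k^'k \<Rightarrow> 'a^('m \<times> 'k)^('m \<times> 'k)" where
  "kronecker A B = (\<chi> p q. A $ fst p $ fst q * B $ snd p $ snd q)"

definition diag_matrix :: "('m \<Rightarrow> 'a::zero) \<Rightarrow> 'a^'m^'m" where
  "diag_matrix d = (\<chi> i j. if i = j then d i else 0)"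

definition matrix_exp :: "real^'m^'m \<Rightarrow> real^'m^'m" where
  "matrix_exp A = (\<Sum>k. (((**) A) ^^ k) (mat 1) /\<^sub>R fact k)"

lemma matrix_exp_0: "matrix_exp (0::real^'m::finite^'m) = mat 1"
proof -
  have "(((**) (0::real^'m^'m)) ^^ k) (mat 1) /\<^sub>R fact k = (if k = 0 then mat 1 else 0)" for k
    by (cases k) auto
  then show ?thesis
    unfolding matrix_exp_def
    using suminf_finite[of "{0::nat}" "\<lambda>k. if k = 0 then mat 1 else (0::real^'m^'m)"] by simp
qed

definition charpoly :: "'a::comm_ring_1^'m^'m \<Rightarrow> 'a poly" where
  "charpoly A = det (mat [:0, 1:] - map_matrix (\<lambda>a. [:a:]) A)"

abbreviation complexify :: "real^'m^'m \<Rightarrow> complex^'m^'m" where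
  "complexify \<equiv> map_matrix complex_of_real"

definition eigenvalue :: "real^'m^'m \<Rightarrow> complex \<Rightarrow> bool" where
  "eigenvalue A \<mu> \<longleftrightarrow> (\<exists>v. v \<noteq> 0 \<and> complexify A *v v = \<mu> *s v)"

text \<open>The complex eigenvalues of a real matrix, listed with algebraic multiplicity.\<close>

definition eigenvalues :: "real^'m^'m \<Rightarrow> complex multiset" where
  "eigenvalues A = proots (charpoly (complexify A))"


section \<open>Gradient and Hessian\<close>

definition gradient :: "('a::real_inner \<Rightarrow> real) \<Rightarrow> 'a \<Rightarrow> 'a" where
  "gradient f x = (THE D. GDERIV f x :> D)"

definition hessian :: "(real^'m \<Rightarrow> real) \<Rightarrow> real^'m \<Rightarrow> real^'m^'m" where
  "hessian f x = jacobian (gradient f) (at x)"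


section \<open>The planar \<open>N\<close>-vortex problem\<close>

text \<open>
  The vortices are indexed by a finite linearly ordered type \<open>'n\<close>, so that \<open>N = CARD('n)\<close>, and
  a vector of \<open>(\<real>\<^sup>2)\<^sup>N\<close> is represented by its \<open>2 N\<close> coordinates: \<open>z $ (i, a)\<close> is the coordinate
  \<open>a\<close> of the position of vortex \<open>i\<close>.
\<close>

type_synonym 'n config = "real^('n \<times> 2)"

definition vortex :: "'n::finite config \<Rightarrow> 'n \<Rightarrow> real^2" where
  "vortex z i = (\<chi> a. z $ (i, a))"

definition collision_free :: "'n::finite config set" where
  "collision_free = {z. \<forall>i j. i \<noteq> j \<longrightarrow> vortex z i \<noteq> vortex z j}"

definition hamiltonian :: "('n \<Rightarrow> real) \<Rightarrow> 'n::{finite,linorder} config \<Rightarrow> real" where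
  "hamiltonian \<Gamma> z =
     - (\<Sum>(i, j)\<in>{(i, j). i < j}. \<Gamma> i * \<Gamma> j * ln (norm (vortex z i - vortex z j)))"

definition J_matrix :: "real^2^2" where
  "J_matrix = vector [vector [0, 1], vector [-1, 0]]"

definition K_matrix :: "real^('n::finite \<times> 2)^('n \<times> 2)" where
  "K_matrix = kronecker (mat 1) J_matrix"

definition circulation_matrix :: "('n \<Rightarrow> real) \<Rightarrow> real^('n::finite \<times> 2)^('n \<times> 2)" where
  "circulation_matrix \<Gamma> = kronecker (diag_matrix \<Gamma>) (mat 1)"

definition central_configuration ::
    "('n \<Rightarrow> real) \<Rightarrow> real \<Rightarrow> 'n::{finite,linorder} config \<Rightarrow> bool" where
  "central_configuration \<Gamma> \<omega> \<xi> \<longleftrightarrow>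
     \<xi> \<in> collision_free \<and>
     gradient (hamiltonian \<Gamma>) \<xi> + \<omega> *\<^sub>R (circulation_matrix \<Gamma> *v \<xi>) = 0"

definition relative_equilibrium :: "real \<Rightarrow> 'n::finite config \<Rightarrow> real \<Rightarrow> 'n config" where
  "relative_equilibrium \<omega> \<xi> t = matrix_exp ((- \<omega> * t) *\<^sub>R K_matrix) *v \<xi>"

lemma relative_equilibrium_0:
  fixes \<xi> :: "'n::finite config"
  shows "relative_equilibrium \<omega> \<xi> 0 = \<xi>"
  by (simp add: relative_equilibrium_def matrix_exp_0)


section \<open>Linear stability\<close>

definition scaled_hessian ::
    "('n \<Rightarrow> real) \<Rightarrow> 'n::{finite,linorder} config \<Rightarrow> real^('n \<times> 2)^('n \<times> 2)" where
  "scaled_hessian \<Gamma> \<xi> = matrix_inv (circulation_matrix \<Gamma>) ** hessian (hamiltonian \<Gamma>) \<xi>"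

definition stability_matrix ::
    "('n \<Rightarrow> real) \<Rightarrow> real \<Rightarrow> 'n::{finite,linorder} config \<Rightarrow> real^('n \<times> 2)^('n \<times> 2)" where
  "stability_matrix \<Gamma> \<omega> \<xi> = K_matrix ** (scaled_hessian \<Gamma> \<xi> + \<omega> *\<^sub>R mat 1)"

text \<open>
  If \<open>\<omega> \<noteq> 0\<close> and \<open>\<xi>\<close> is a central configuration, then translation, rotation and scaling produce
  the eigenvalues that are subtracted here, so both multisets have size \<open>2 N - 4\<close>.
\<close>

definition nontrivial_stability_eigenvalues ::
    "('n \<Rightarrow> real) \<Rightarrow> real \<Rightarrow> 'n::{finite,linorder} config \<Rightarrow> complex multiset" where
  "nontrivial_stability_eigenvalues \<Gamma> \<omega> \<xi> =
     eigenvalues (stability_matrix \<Gamma> \<omega> \<xi>) - {#0, 0, \<i> * of_real \<omega>, - \<i> * of_real \<omega>#}"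

definition nontrivial_hessian_eigenvalues ::
    "('n \<Rightarrow> real) \<Rightarrow> real \<Rightarrow> 'n::{finite,linorder} config \<Rightarrow> complex multiset" where
  "nontrivial_hessian_eigenvalues \<Gamma> \<omega> \<xi> =
     eigenvalues (scaled_hessian \<Gamma> \<xi>) - {#0, 0, of_real \<omega>, - of_real \<omega>#}"

text \<open>
  The following two notions are meant for a relative equilibrium \<open>z\<close> with angular velocity \<open>\<omega>\<close>.
  The central configuration that generates \<open>z\<close> is \<open>z 0\<close>, see \<open>relative_equilibrium_0\<close>.
\<close>

definition nondegenerate ::
    "('n \<Rightarrow> real) \<Rightarrow> real \<Rightarrow> (real \<Rightarrow> 'n::{finite,linorder} config) \<Rightarrow> bool" where
  "nondegenerate \<Gamma> \<omega> z \<longleftrightarrow>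
     (\<forall>l\<in>#nontrivial_stability_eigenvalues \<Gamma> \<omega> (z 0). l \<noteq> 0)"

definition spectrally_stable ::
    "('n \<Rightarrow> real) \<Rightarrow> real \<Rightarrow> (real \<Rightarrow> 'n::{finite,linorder} config) \<Rightarrow> bool" where
  "spectrally_stable \<Gamma> \<omega> z \<longleftrightarrow>
     nondegenerate \<Gamma> \<omega> z \<and>
     (\<forall>l\<in>#nontrivial_stability_eigenvalues \<Gamma> \<omega> (z 0). Re l = 0)"

end

theory Submission
  imports Defs
begin

text \<open>
  Write \<open>A = M\<^sub>\<Gamma>\<^sup>-\<^sup>1 D\<^sup>2H(\<xi>)\<close> and \<open>B = K (A + \<omega>)\<close>. As the logarithm is harmonic in the plane, the
  \<open>2 \<times> 2\<close> blocks of \<open>D\<^sup>2H(\<xi>)\<close> are symmetric and traceless, so \<open>K\<close> anticommutes with \<open>A\<close>. Hence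
  \<open>A\<close> is similar to \<open>- A\<close>, and \<open>B\<^sup>2 = A\<^sup>2 - \<omega>\<^sup>2\<close>: the eigenvalues of \<open>B\<close> are, up to sign, the
  square roots of \<open>\<mu>\<^sup>2 - \<omega>\<^sup>2\<close> for the eigenvalues \<open>\<mu>\<close> of \<open>A\<close>. For the multiplicities, the
  characteristic polynomials \<open>p\<^sub>X\<close> satisfy \<open>p\<^sub>X(x) p\<^sub>-\<^sub>X(x) = p\<^sub>Y(x\<^sup>2)\<close> with \<open>Y = X\<^sup>2\<close>; comparing the orders
  of vanishing shows that the multiplicity of \<open>0\<close> for \<open>B\<close> is twice the multiplicity of \<open>\<omega>\<close>, or of
  \<open>-\<omega>\<close>, for \<open>A\<close>.
\<close>

no_notation fps_nth (infixl "$" 75)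

section \<open>Characteristic polynomials\<close>

lemma order_power:
  fixes p :: "'a::idom poly"
  assumes "p \<noteq> 0"
  shows "order a (p ^ n) = n * order a p"
  using assms by (induction n) (auto simp: order_mult)

text \<open>With \<open>c = q(a)\<close>, write \<open>p = (x - c)^n u\<close> where
  \<open>u(c)\<close> is nonzero. Composing gives \<open>(q - c)^n (u o q)\<close>, and the second
  factor does not vanish at \<open>a\<close>.\<close>

lemma order_pcompose:
  fixes p q :: "'a::field poly"
  assumes "p \<noteq> 0" and q: "q - [:poly q a:] \<noteq> 0"
  shows "order a (p \<circ>\<^sub>p q) = order (poly q a) p * order a (q - [:poly q a:])"
proof -
  define c where "c = poly q a"
  obtain u where u: "p = [:-c, 1:] ^ order c p * u" "\<not> [:-c, 1:] dvd u"
    using order_decomp[OF \<open>p \<noteq> 0\<close>] by blast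
  define n where "n = order c p"
  have pc: "[:-c, 1:] ^ k \<circ>\<^sub>p q = (q - [:c:]) ^ k" for k
  proof (induction k)
    case (Suc k)
    then show ?case
      unfolding power_Suc pcompose_mult by (simp add: pcompose_pCons)
  qed (simp add: pcompose_1)
  have "p \<circ>\<^sub>p q = (q - [:c:]) ^ n * (u \<circ>\<^sub>p q)"
    using u(1) pc by (metis n_def pcompose_mult)
  moreover have uc: "poly (u \<circ>\<^sub>p q) a \<noteq> 0"
    using u(2) by (simp add: poly_pcompose c_def poly_eq_0_iff_dvd)
  then have "u \<circ>\<^sub>p q \<noteq> 0" "order a (u \<circ>\<^sub>p q) = 0"
    by (auto simp: order_root)
  moreover have "(q - [:c:]) ^ n \<noteq> 0"
    using q by (simp add: c_def)
  ultimately show ?thesis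
    using q by (simp add: order_mult order_power n_def c_def)
qed

section \<open>Scalar matrices, and determinants under ring homomorphisms\<close>

lemma map_matrix_mat: "f 0 = 0 \<Longrightarrow> map_matrix f (mat a) = mat (f a)"
  by (simp add: vec_eq_iff mat_def)

lemma matrix_add_rdistrib: "(A + B) ** C = A ** C + B ** C" for A :: "'a::semiring_1^'n^'m"
  by (simp add: vec_eq_iff matrix_matrix_mult_def distrib_right sum.distrib)

lemma matrix_mul_minus_left: "(- A) ** B = - (A ** B)" for A :: "'a::ring_1^'n^'m"
  by (simp add: vec_eq_iff matrix_matrix_mult_def sum_negf)

lemma matrix_mul_minus_right: "A ** (- B) = - (A ** B)" for A :: "'a::ring_1^'n^'m"
  by (simp add: vec_eq_iff matrix_matrix_mult_def sum_negf)

lemma mat_mul_left: "mat c ** A = (\<chi> i j. c * A $ i $ j)" for A :: "'a::semiring_1^'n^'m"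
  by (simp add: vec_eq_iff matrix_matrix_mult_def mat_def if_distrib[of "\<lambda>x. x * _"] sum.delta cong: if_cong)

lemma mat_mul_right: "A ** mat c = (\<chi> i j. A $ i $ j * c)" for A :: "'a::semiring_1^'n^'m"
  by (simp add: vec_eq_iff matrix_matrix_mult_def mat_def if_distrib[of "\<lambda>x. _ * x"] sum.delta cong: if_cong)

lemma mat_mul_commute: "mat c ** A = A ** mat c" for A :: "'a::comm_semiring_1^'n^'n"
  by (simp add: mat_mul_left mat_mul_right mult.commute)

text \<open>The determinant is an integer polynomial in the entries, so it commutes with ring
  homomorphisms. It serves for evaluation of polynomials at a point and for composition with a fixed
  polynomial.\<close>

lemma det_map_matrix:
  fixes h :: "'a::comm_ring_1 \<Rightarrow> 'b::comm_ring_1" and A :: "'a^'n^'n"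
  assumes "h 0 = 0" "h 1 = 1" "\<And>x y. h (x + y) = h x + h y" "\<And>x y. h (x * y) = h x * h y"
  shows "det (map_matrix h A) = h (det A)"
proof -
  have s: "h (sum f S) = (\<Sum>x\<in>S. h (f x))" for f :: "('n \<Rightarrow> 'n) \<Rightarrow> 'a" and S
    by (induction S rule: infinite_finite_induct) (auto simp: assms)
  have p: "h (prod f S) = (\<Prod>x\<in>S. h (f x))" for f :: "'n \<Rightarrow> 'a" and S
    by (induction S rule: infinite_finite_induct) (auto simp: assms)
  have m: "h (- x) = - h x" for x
    using assms(1,3) by (metis add_eq_0_iff)
  have i: "h (of_int (sign q)) = of_int (sign q)" for q :: "'n \<Rightarrow> 'n"
    by (auto simp: sign_def assms m)
  show ?thesis
    by (simp add: det_def s p i assms(4))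
qed

section \<open>Identities for characteristic polynomials\<close>

lemma poly_charpoly: "poly (charpoly A) x = det (mat x - A)"
proof -
  have "poly (charpoly A) x = det (map_matrix (\<lambda>p. poly p x) (mat [:0, 1:] - map_matrix (\<lambda>a. [:a:]) A))"
    unfolding charpoly_def by (rule det_map_matrix[symmetric]) auto
  also have "map_matrix (\<lambda>p. poly p x) (mat [:0, 1:] - map_matrix (\<lambda>a. [:a:]) A) = mat x - A"
    by (simp add: vec_eq_iff mat_def)
  finally show ?thesis .
qed

text \<open>The substitutions \<open>x + c\<close>, \<open>-x\<close> and \<open>x^2\<close> used
  below are all instances of this formula.\<close>

lemma charpoly_pcompose:
  "charpoly A \<circ>\<^sub>p q = det (mat q - map_matrix (\<lambda>a. [:a:]) A)"
proof -
  have "charpoly A \<circ>\<^sub>p q = det (map_matrix (\<lambda>p. p \<circ>\<^sub>p q) (mat [:0, 1:] - map_matrix (\<lambda>a. [:a:]) A))"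
    unfolding charpoly_def
    by (rule det_map_matrix[symmetric]) (auto simp: pcompose_add pcompose_mult pcompose_1)
  also have "map_matrix (\<lambda>p. p \<circ>\<^sub>p q) (mat [:0, 1:] - map_matrix (\<lambda>a. [:a:]) A) = mat q - map_matrix (\<lambda>a. [:a:]) A"
    by (simp add: vec_eq_iff mat_def pcompose_diff pcompose_pCons)
  finally show ?thesis .
qed

lemma charpoly_shift: "charpoly (A - mat c) = charpoly A \<circ>\<^sub>p [:c, 1:]"
  unfolding charpoly_pcompose by (simp add: charpoly_def) (rule arg_cong[of _ _ det], simp add: vec_eq_iff mat_def)

lemma map_matrix_pCons_mul:
  "map_matrix (\<lambda>a. [:a:]) (A ** B) = map_matrix (\<lambda>a. [:a:]) A ** map_matrix (\<lambda>a. [:a:]) B"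
  for A :: "'a::comm_ring_1^'n^'m" and B :: "'a^'k^'n"
proof -
  have "[:sum f S:] = (\<Sum>x\<in>S. [:f x:])" for f :: "'n \<Rightarrow> 'a" and S
    by (induction S rule: infinite_finite_induct) (auto simp del: add_pCons simp flip: add_pCons[of _ 0 _ 0, simplified])
  then show ?thesis
    by (simp add: vec_eq_iff matrix_matrix_mult_def mult.commute)
qed

text \<open>Take determinants in \<open>(x - A)(x + A) = x^2 - A^2\<close>, which holds because
  scalar matrices are central.\<close>

lemma charpoly_square:
  "charpoly (A ** A) \<circ>\<^sub>p [:0, 0, 1:] = charpoly A * charpoly (- A)"
proof -
  let ?C = "map_matrix (\<lambda>a. [:a:]) A" and ?X = "mat [:0, 1:]"
  have "charpoly A * charpoly (- A) = det ((?X - ?C) ** (?X - (- ?C)))"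
    unfolding charpoly_def det_mul
    by (rule arg_cong[of _ _ "\<lambda>x. _ * det x"]) (simp add: vec_eq_iff)
  also have "(?X - ?C) ** (?X - (- ?C)) = ?X ** ?X - ?C ** ?C"
    using matrix_add_ldistrib[of "?X - ?C" ?X ?C] matrix_add_rdistrib[of ?X "- ?C" ?X]
      matrix_add_rdistrib[of ?X "- ?C" ?C]
    by (simp add: matrix_mul_minus_left mat_mul_commute[of _ ?C])
  also have "?X ** ?X = mat [:0, 0, 1:]"
    by (simp add: mat_mul_left) (simp add: vec_eq_iff mat_def)
  finally show ?thesis
    by (simp add: charpoly_pcompose map_matrix_pCons_mul)
qed

lemma charpoly_uminus: "charpoly (- A) = smult ((- 1) ^ CARD('n)) (charpoly A \<circ>\<^sub>p [:0, -1:])"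
  for A :: "'a::comm_ring_1^'n^'n"
proof -
  let ?C = "map_matrix (\<lambda>a. [:a:]) A"
  have "charpoly (- A) = det (\<chi> i. - 1 *s ((mat [:0, -1:] - ?C) $ i))"
    unfolding charpoly_def by (rule arg_cong[of _ _ det]) (auto simp: vec_eq_iff mat_def)
  also have "\<dots> = (- 1) ^ CARD('n) * (charpoly A \<circ>\<^sub>p [:0, -1:])"
    by (subst det_rows_mul) (simp add: charpoly_pcompose)
  also have "(- 1 :: 'a poly) ^ CARD('n) = [:(- 1) ^ CARD('n) :: 'a:]"
    by (simp add: minus_one_power_iff) (simp add: one_pCons)
  finally show ?thesis by simp
qed

text \<open>\<open>P (x - A) Q = x - P A Q\<close>, since \<open>x\<close> is central and
  \<open>P Q = 1\<close> remains true over the polynomial ring.\<close>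

lemma charpoly_similar:
  fixes A P Q :: "'a::comm_ring_1^'n^'n"
  assumes "P ** Q = mat 1"
  shows "charpoly (P ** A ** Q) = charpoly A"
proof -
  let ?m = "map_matrix (\<lambda>a. [:a:])"
  have PQ: "?m P ** ?m Q = mat 1"
    by (simp flip: map_matrix_pCons_mul add: assms) (simp add: vec_eq_iff mat_def one_pCons)
  have "?m P ** (mat [:0, 1:] - ?m A) ** ?m Q = ?m P ** mat [:0,1:] ** ?m Q - ?m P ** ?m A ** ?m Q"
    using matrix_add_ldistrib[of "?m P" "mat [:0,1:]" "- ?m A"]
      matrix_add_rdistrib[of "?m P ** mat [:0,1:]" "- (?m P ** ?m A)" "?m Q"]
    by (simp add: matrix_mul_minus_left matrix_mul_minus_right)
  also have "?m P ** mat [:0,1:] ** ?m Q = mat [:0, 1:]"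
    by (simp add: PQ flip: mat_mul_commute[of _ "?m P"] matrix_mul_assoc)
  finally have "charpoly (P ** A ** Q) = det (?m P ** (mat [:0, 1:] - ?m A) ** ?m Q)"
    by (simp add: charpoly_def map_matrix_pCons_mul)
  also have "\<dots> = det (?m P ** ?m Q) * charpoly A"
    by (simp add: det_mul charpoly_def)
  finally show ?thesis by (simp add: PQ)
qed

text \<open>If \<open>det (\<lambda> - A)\<close> vanished for all \<open>\<lambda>\<close>, then \<open>det (1 - t A)\<close> would vanish for all \<open>t \<noteq> 0\<close>,
  yet it is a polynomial in \<open>t\<close> with value \<open>1\<close> at \<open>0\<close>.\<close>
lemma charpoly_nonzero:
  fixes A :: "complex^'n^'n"
  shows "charpoly A \<noteq> 0"
proof
  assume z: "charpoly A = 0"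
  define Q where "Q = det (mat 1 - map_matrix (\<lambda>a. [:0, a:]) A)"
  have Q: "poly Q t = det (mat 1 - map_matrix (\<lambda>a. t * a) A)" for t
  proof -
    have "poly Q t = det (map_matrix (\<lambda>p. poly p t) (mat 1 - map_matrix (\<lambda>a. [:0, a:]) A))"
      unfolding Q_def by (rule det_map_matrix[symmetric]) auto
    also have "map_matrix (\<lambda>p. poly p t) (mat 1 - map_matrix (\<lambda>a. [:0, a:]) A) = mat 1 - map_matrix (\<lambda>a. t * a) A"
      by (simp add: vec_eq_iff mat_def)
    finally show ?thesis .
  qed
  have "poly Q t = 0" if "t \<noteq> 0" for t
  proof -
    \<comment> \<open>Each row of \<open>1 - t A\<close> is \<open>t\<close> times the corresponding
      row of \<open>1/t - A\<close>.\<close>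
    have "poly Q t = det (\<chi> i. t *s ((mat (1 / t) - A) $ i))"
      unfolding Q using that
      by (intro arg_cong[of _ _ det]) (auto simp: vec_eq_iff mat_def algebra_simps)
    also have "\<dots> = t ^ CARD('n) * det (mat (1 / t) - A)"
      by (subst det_rows_mul) simp
    finally show ?thesis
      by (simp add: z flip: poly_charpoly)
  qed
  then have "infinite {t. poly Q t = 0}"
    using infinite_super[of "- {0}" "{t. poly Q t = 0}"] by (auto simp: infinite_UNIV_char_0)
  then have "Q = 0"
    using poly_roots_finite by blast
  moreover have "mat 1 - map_matrix (\<lambda>a. 0 * a) A = mat 1"
    by (simp add: vec_eq_iff)
  then have "poly Q 0 = 1"
    unfolding Q by (simp only: det_I)
  ultimately show False by simp
qed

section \<open>Eigenvalues as roots, and multiplicities under negation and squaring\<close>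

lemma eigenvalue_iff_root: "eigenvalue A \<mu> \<longleftrightarrow> poly (charpoly (complexify A)) \<mu> = 0"
proof -
  let ?M = "mat \<mu> - complexify A"
  have "?M *v v = \<mu> *s v - complexify A *v v" for v
    by (simp add: matrix_vector_mult_diff_rdistrib) (simp add: vec_eq_iff matrix_vector_mult_def mat_def if_distrib[of "\<lambda>x. x * _"] cong: if_cong)
  then have "eigenvalue A \<mu> \<longleftrightarrow> \<not> (\<forall>v. ?M *v v = 0 \<longrightarrow> v = 0)"
    unfolding eigenvalue_def by (metis right_minus_eq)
  also have "\<dots> \<longleftrightarrow> det ?M = 0"
    by (metis invertible_det_nz invertible_left_inverse matrix_left_invertible_ker)
  finally show ?thesis by (simp add: poly_charpoly)
qed

lemma count_eigenvalues: "count (eigenvalues A) \<mu> = order \<mu> (charpoly (complexify A))"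
  by (simp add: eigenvalues_def charpoly_nonzero)

lemma order_charpoly_uminus: "order (- a) (charpoly (- A)) = order a (charpoly A)" for A :: "complex^'n^'n"
proof -
  have "order (-a) (charpoly A \<circ>\<^sub>p [:0, -1:]) = order a (charpoly A) * order (-a) [:- a, -1:]"
    by (subst order_pcompose) (auto simp: charpoly_nonzero)
  also have "[:- a, -1:] = smult (-1) [:- (- a), 1:]" by simp
  also have "order (-a) \<dots> = 1"
    by (subst order_smult) (use order_power_n_n[of "-a" 1] in auto)
  finally show ?thesis
    by (simp add: charpoly_uminus order_smult)
qed

text \<open>Compare the orders at \<open>a\<close> of both sides of \<open>charpoly_square\<close>.
  The factor on the left is the order at \<open>a\<close> of \<open>x^2 - a^2\<close>, coming from
  the substitution of \<open>x^2\<close>.\<close>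

lemma order_charpoly_square:
  fixes A :: "complex^'n^'n"
  shows "order (a\<^sup>2) (charpoly (A ** A)) * order a [:- a\<^sup>2, 0, 1:] = order a (charpoly A) + order (- a) (charpoly A)"
proof -
  have "order a (charpoly (A ** A) \<circ>\<^sub>p [:0, 0, 1:]) = order a (charpoly A) + order a (charpoly (- A))"
    unfolding charpoly_square by (rule order_mult) (simp add: charpoly_nonzero)
  moreover have "order a (charpoly (- A)) = order (- a) (charpoly A)"
    using order_charpoly_uminus[of "- a" A] by simp
  ultimately show ?thesis
    by (subst (asm) order_pcompose) (auto simp: charpoly_nonzero power2_eq_square)
qed

text \<open>The map \<open>x^2\<close> is ramified only at 0, where the factors \<open>x - a\<close>
  and \<open>x + a\<close> coincide.\<close>

lemma order_square_minus_square:
  fixes a :: complex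
  shows "order a [:- a\<^sup>2, 0, 1:] = (if a = 0 then 2 else 1)"
proof -
  have "[:- a\<^sup>2, 0, 1:] = [:- a, 1:] * [:a, 1:]"
    by (simp add: power2_eq_square)
  also have "order a \<dots> = order a [:- a, 1:] + order a [:a, 1:]"
    by (rule order_mult) auto
  also have "order a [:- a, 1:] = 1"
    using order_power_n_n[of a 1] by simp
  also have "order a [:a, 1:] = (if a = 0 then 1 else 0)"
    using order_power_n_n[of a 1] by (auto simp: order_root intro!: order_0I)
  finally show ?thesis by simp
qed

text \<open>Moving \<open>K\<close> to the right past \<open>A + w\<close> flips the sign of
  \<open>A\<close>. The square becomes \<open>(-A + w) K^2 (A + w)\<close>, and
  \<open>K^2 = -1\<close> turns this into \<open>(A - w)(A + w)\<close>.\<close>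

lemma square_anticommuting:
  fixes A K :: "complex^'n^'n"
  assumes "K ** K = - mat 1" and KA: "K ** A = - (A ** K)"
  shows "(K ** (A + mat w)) ** (K ** (A + mat w)) = A ** A - mat (w\<^sup>2)"
proof -
  have "(K ** (A + mat w)) = (- A + mat w) ** K"
    using matrix_add_rdistrib[of "- A" "mat w" K]
    by (simp add: matrix_add_ldistrib KA mat_mul_commute matrix_mul_minus_left)
  then have "(K ** (A + mat w)) ** (K ** (A + mat w)) = (- A + mat w) ** (K ** K) ** (A + mat w)"
    by (metis matrix_mul_assoc)
  also have "\<dots> = (A - mat w) ** (A + mat w)"
    by (simp add: assms(1) matrix_mul_minus_right)
  also have "\<dots> = A ** A + A ** mat w - mat w ** A - mat w ** mat w"
    using matrix_add_rdistrib[of A "- mat w" A] matrix_add_rdistrib[of A "- mat w" "mat w"]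
    by (simp add: matrix_add_ldistrib matrix_mul_minus_left)
  also have "mat w ** mat w = (mat (w\<^sup>2) :: complex^'n^'n)"
    by (simp add: mat_mul_left) (simp add: vec_eq_iff mat_def power2_eq_square)
  finally show ?thesis by (simp add: mat_mul_commute[of _ A])
qed

lemma map_matrix_of_real_mult:
  "complexify (A ** B) = complexify A ** complexify B"
  by (simp add: vec_eq_iff matrix_matrix_mult_def)

text \<open>A square root \<open>l\<close> of \<open>m\<^sup>2 - w\<^sup>2\<close> is purely imaginary iff \<open>m\<^sup>2\<close> is real and at most \<open>w\<^sup>2\<close>.\<close>
lemma imaginary_iff_square_le:
  fixes l m :: complex and w :: real
  assumes "l\<^sup>2 = m\<^sup>2 - (of_real w)\<^sup>2"
  shows "Re l = 0 \<longleftrightarrow> Re m = 0 \<or> m \<in> \<real> \<and> Re m \<in> {- \<bar>w\<bar>..\<bar>w\<bar>}"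
proof -
  have re: "(Re l)\<^sup>2 - (Im l)\<^sup>2 = (Re m)\<^sup>2 - (Im m)\<^sup>2 - w\<^sup>2" and im: "Re l * Im l = Re m * Im m"
    using assms by (auto simp: complex_eq_iff power2_eq_square mult.commute)
  have le: "Re m \<in> {- \<bar>w\<bar>..\<bar>w\<bar>} \<longleftrightarrow> (Re m)\<^sup>2 \<le> w\<^sup>2"
    by (metis abs_le_iff abs_le_square_iff atLeastAtMost_iff minus_le_iff)
  show ?thesis
    unfolding le complex_is_Real_iff
  proof
    assume "Re l = 0"
    then have "Re m = 0 \<or> Im m = 0" "(Re l)\<^sup>2 = 0"
      using im by auto
    moreover from this have "(Re m)\<^sup>2 \<le> (Im m)\<^sup>2 + w\<^sup>2"
      using re zero_le_power2[of "Im l"] by linarith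
    ultimately show "Re m = 0 \<or> Im m = 0 \<and> (Re m)\<^sup>2 \<le> w\<^sup>2" by auto
  next
    assume m: "Re m = 0 \<or> Im m = 0 \<and> (Re m)\<^sup>2 \<le> w\<^sup>2"
    then have "Re l = 0 \<or> Im l = 0" using im by auto
    moreover have "(Re l)\<^sup>2 \<le> (Im l)\<^sup>2"
    proof -
      have "(Re m)\<^sup>2 \<le> (Im m)\<^sup>2 + w\<^sup>2" using m by auto
      then show ?thesis using re by linarith
    qed
    ultimately show "Re l = 0" by auto
  qed
qed

section \<open>Spectrum of \<open>K (A + w)\<close> when \<open>A\<close> anticommutes with a
  complex structure \<open>K\<close>\<close>

context
  fixes A K B :: "real^'n^'n" and w :: real
  assumes K: "K ** K = - mat 1" and anti: "K ** A = - (A ** K)" and w: "w \<noteq> 0"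
    and B: "B = K ** (A + w *\<^sub>R mat 1)"
begin

text \<open>The inverse of \<open>K\<close> is \<open>- K\<close>, so anticommutation says that
  conjugation by \<open>K\<close> takes \<open>A\<close> to \<open>- A\<close>.\<close>

lemma charpoly_uminus_anticommuting: "charpoly (- complexify A) = charpoly (complexify A)"
proof -
  have "K ** A ** (- K) = - A"
    by (simp add: anti matrix_mul_minus_left matrix_mul_minus_right K flip: matrix_mul_assoc)
  then have "complexify K ** complexify A ** complexify (- K) = - complexify A"
    by (simp flip: map_matrix_of_real_mult) (simp add: vec_eq_iff)
  moreover have "complexify K ** complexify (- K) = mat 1"
    by (simp add: matrix_mul_minus_right K map_matrix_mat flip: map_matrix_of_real_mult)
  ultimately show ?thesis
    by (metis charpoly_similar)
qed

lemma charpoly_stability_square: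
  "charpoly (complexify B ** complexify B)
    = charpoly (complexify A ** complexify A) \<circ>\<^sub>p [:(of_real w)\<^sup>2, 1:]"
proof -
  have m: "complexify (- X) = - complexify X" "complexify (X + Y) = complexify X + complexify Y"
    "complexify (w *\<^sub>R mat 1) = mat (of_real w)" for X Y :: "real^'n^'n"
    by (simp_all add: vec_eq_iff mat_def)
  have "complexify K ** complexify K = - mat 1"
    by (simp add: K m map_matrix_mat flip: map_matrix_of_real_mult)
  moreover have "complexify K ** complexify A = - (complexify A ** complexify K)"
    by (simp add: anti m flip: map_matrix_of_real_mult)
  ultimately have "complexify B ** complexify B = complexify A ** complexify A - mat ((of_real w)\<^sup>2)"
    unfolding B map_matrix_of_real_mult m by (rule square_anticommuting)
  then show ?thesis
    by (simp add: charpoly_shift)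
qed

text \<open>The multiplicity of 0 is the same for \<open>B\<close> and for
  \<open>B^2 = A^2 - w^2\<close>, hence equals that of \<open>w^2\<close> for \<open>A^2\<close>.
  The latter is the sum of the multiplicities of \<open>w\<close> and \<open>-w\<close> for
  \<open>A\<close>, which agree because \<open>A\<close> is similar to \<open>- A\<close>.\<close>

lemma order_charpoly_stability:
  shows "order 0 (charpoly (complexify B)) = 2 * order (of_real w) (charpoly (complexify A))"
    and "order (- of_real w) (charpoly (complexify A)) = order (of_real w) (charpoly (complexify A))"
proof -
  let ?w = "complex_of_real w" and ?A = "complexify A" and ?B = "complexify B"
  show *: "order (- ?w) (charpoly ?A) = order ?w (charpoly ?A)"
    using order_charpoly_uminus[of ?w ?A] by (simp add: charpoly_uminus_anticommuting)
  have "order (?w\<^sup>2) (charpoly (?A ** ?A)) = 2 * order ?w (charpoly ?A)"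
    using order_charpoly_square[of ?w ?A] w by (simp add: order_square_minus_square *)
  \<comment> \<open>At 0 the ramification factor 2 cancels against the two equal summands.\<close>
  moreover have "order 0 (charpoly (?B ** ?B)) = order 0 (charpoly ?B)"
    using order_charpoly_square[of 0 ?B] order_square_minus_square[of 0] by simp
  moreover have "order 0 (charpoly (?B ** ?B)) = order (?w\<^sup>2) (charpoly (?A ** ?A))"
    unfolding charpoly_stability_square
    using order_power_n_n[of "0::complex" 1] by (subst order_pcompose) (auto simp: charpoly_nonzero)
  ultimately show "order 0 (charpoly ?B) = 2 * order ?w (charpoly ?A)"
    by simp
qed

text \<open>Both sides say that \<open>l^2\<close> is an eigenvalue of \<open>B^2\<close>. For
  \<open>A\<close> the signs \<open>m\<close> and \<open>-m\<close> are interchangeable by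
  similarity; the argument leaves the sign open for \<open>B\<close>, whence the
  disjunction.\<close>

lemma eigenvalue_stability_iff:
  assumes "l\<^sup>2 = m\<^sup>2 - (of_real w)\<^sup>2"
  shows "eigenvalue B l \<or> eigenvalue B (- l) \<longleftrightarrow> eigenvalue A m"
proof -
  have sq: "poly (charpoly (X ** X)) (x\<^sup>2) = poly (charpoly X) x * poly (charpoly (- X)) x"
    for X :: "complex^'n^'n" and x
    using arg_cong[OF charpoly_square[of X], of "\<lambda>p. poly p x"]
    by (simp add: poly_pcompose power2_eq_square)
  have "poly (charpoly (complexify B ** complexify B)) (l\<^sup>2)
      = poly (charpoly (complexify A ** complexify A)) (m\<^sup>2)"
    using assms by (simp add: charpoly_stability_square poly_pcompose algebra_simps)
  moreover have "poly (charpoly (- complexify B)) l = 0 \<longleftrightarrow> poly (charpoly (complexify B)) (- l) = 0"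
    by (simp add: charpoly_uminus poly_pcompose)
  ultimately show ?thesis
    by (auto simp: eigenvalue_iff_root sq charpoly_uminus_anticommuting)
qed

text \<open>The open sign of \<open>l\<close> is harmless, as \<open>Re l = 0\<close> is invariant
  under negation.\<close>

lemma all_stability_eigenvalues_imaginary_iff:
  "(\<forall>l. eigenvalue B l \<longrightarrow> Re l = 0) \<longleftrightarrow>
    (\<forall>m. eigenvalue A m \<longrightarrow> Re m = 0 \<or> m \<in> \<real> \<and> Re m \<in> {- \<bar>w\<bar>..\<bar>w\<bar>})"
proof (intro iffI allI impI)
  fix m assume B: "\<forall>l. eigenvalue B l \<longrightarrow> Re l = 0" and m: "eigenvalue A m"
  have l: "(csqrt (m\<^sup>2 - (of_real w)\<^sup>2))\<^sup>2 = m\<^sup>2 - (of_real w)\<^sup>2"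
    by simp
  then have "Re (csqrt (m\<^sup>2 - (of_real w)\<^sup>2)) = 0"
    using B m eigenvalue_stability_iff[OF l] by fastforce
  then show "Re m = 0 \<or> m \<in> \<real> \<and> Re m \<in> {- \<bar>w\<bar>..\<bar>w\<bar>}"
    using imaginary_iff_square_le[OF l] by blast
next
  fix l assume A: "\<forall>m. eigenvalue A m \<longrightarrow> Re m = 0 \<or> m \<in> \<real> \<and> Re m \<in> {- \<bar>w\<bar>..\<bar>w\<bar>}"
    and l: "eigenvalue B l"
  \<comment> \<open>Any square root of \<open>l^2 + w^2\<close> serves as the eigenvalue
    \<open>m\<close> of \<open>A\<close> that corresponds to \<open>l\<close>.\<close>
  have "l\<^sup>2 = (csqrt (l\<^sup>2 + (of_real w)\<^sup>2))\<^sup>2 - (of_real w)\<^sup>2"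
    by simp
  with A l show "Re l = 0"
    using imaginary_iff_square_le eigenvalue_stability_iff by blast
qed

end

section \<open>The Hessian of the Hamiltonian\<close>

lemma kronecker_mult:
  "kronecker A B ** kronecker C D = kronecker (A ** C) (B ** D)"
  for A C :: "'a::comm_semiring_1^'m^'m" and B D :: "'a^'k^'k"
proof -
  have "(\<Sum>r\<in>UNIV. A $ i $ fst r * B $ a $ snd r * (C $ fst r $ j * D $ snd r $ b))
      = (\<Sum>k\<in>UNIV. A $ i $ k * C $ k $ j) * (\<Sum>c\<in>UNIV. B $ a $ c * D $ c $ b)" for i j a b
    unfolding sum_product sum.cartesian_product UNIV_Times_UNIV
    by (rule sum.cong) (auto simp: ac_simps)
  then show ?thesis
    by (simp add: kronecker_def matrix_matrix_mult_def vec_eq_iff)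
qed

lemma kronecker_mat_1:
  "kronecker (mat 1) (mat 1) = (mat 1 :: 'a::semiring_1^('m::finite \<times> 'k::finite)^('m \<times> 'k))"
  by (auto simp: kronecker_def vec_eq_iff mat_def)

lemma kronecker_minus_right: "kronecker A (- B) = - kronecker A B" for A :: "'a::ring^'m^'m"
  by (simp add: kronecker_def vec_eq_iff)

lemma transpose_kronecker: "transpose (kronecker A B) = kronecker (transpose A) (transpose B)"
  by (simp add: kronecker_def transpose_def vec_eq_iff)

lemma diag_matrix_mult: "diag_matrix a ** diag_matrix b = diag_matrix (\<lambda>i. a i * b i)"
  for a b :: "'n::finite \<Rightarrow> 'a::semiring_1"
  by (simp add: diag_matrix_def matrix_matrix_mult_def vec_eq_iff if_distrib[of "\<lambda>x. x * _"] sum.delta cong: if_cong)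

lemma J_matrix_vec: "J_matrix *v v = vector [v $ 2, - v $ 1]"
  by (simp add: J_matrix_def matrix_vector_mult_def vec_eq_iff forall_2 sum_2)

lemma J_matrix_square: "J_matrix ** J_matrix = - mat 1"
  by (simp add: J_matrix_def matrix_matrix_mult_def vec_eq_iff forall_2 sum_2 mat_def)

lemma transpose_J_matrix: "transpose J_matrix = - J_matrix"
  by (simp add: J_matrix_def transpose_def vec_eq_iff forall_2)

lemma K_matrix_square: "K_matrix ** K_matrix = - mat 1"
  by (simp add: K_matrix_def kronecker_mult J_matrix_square kronecker_minus_right kronecker_mat_1)

lemma transpose_K_matrix: "transpose K_matrix = - K_matrix"
  by (simp add: K_matrix_def transpose_kronecker transpose_J_matrix kronecker_minus_right)

lemma K_matrix_circulation_matrix: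
  "K_matrix ** circulation_matrix \<Gamma> = circulation_matrix \<Gamma> ** K_matrix"
  by (simp add: K_matrix_def circulation_matrix_def kronecker_mult)

text \<open>Circulation matrices multiply through their diagonals. As \<open>matrix_inv\<close>
  chooses some two-sided inverse, uniqueness has to be shown as well.\<close>

lemma matrix_inv_circulation_matrix:
  fixes \<Gamma> :: "'n::finite \<Rightarrow> real"
  assumes "\<And>i. \<Gamma> i \<noteq> 0"
  shows "matrix_inv (circulation_matrix \<Gamma>) = circulation_matrix (\<lambda>i. 1 / \<Gamma> i)"
proof -
  have 1: "circulation_matrix a ** circulation_matrix b = mat 1" if "\<And>i. a i * b i = 1"
    for a b :: "'n \<Rightarrow> real"
  proof -
    have "circulation_matrix a ** circulation_matrix b = kronecker (diag_matrix (\<lambda>i. 1)) (mat 1)"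
      by (simp add: circulation_matrix_def kronecker_mult diag_matrix_mult that)
    also have "diag_matrix (\<lambda>i. 1) = (mat 1 :: real^'n^'n)"
      by (simp add: diag_matrix_def mat_def)
    finally show ?thesis by (simp add: kronecker_mat_1)
  qed
  show ?thesis
    unfolding matrix_inv_def
  proof (rule some_equality)
    fix B assume "circulation_matrix \<Gamma> ** B = mat 1 \<and> B ** circulation_matrix \<Gamma> = mat 1"
    moreover have "circulation_matrix \<Gamma> ** circulation_matrix (\<lambda>i. 1 / \<Gamma> i) = mat 1"
      by (rule 1) (simp add: assms)
    ultimately show "B = circulation_matrix (\<lambda>i. 1 / \<Gamma> i)"
      by (metis matrix_mul_assoc matrix_mul_lid matrix_mul_rid)
  qed (auto intro!: 1 simp: assms)
qed

lemma vortex_K_matrix: "vortex (K_matrix *v h) i = J_matrix *v vortex h i"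
proof -
  have "(\<Sum>p\<in>UNIV. K_matrix $ (i, a) $ p * h $ p) = (\<Sum>b\<in>UNIV. J_matrix $ a $ b * h $ (i, b))" for a
  proof -
    have "(\<Sum>p\<in>UNIV. K_matrix $ (i, a) $ p * h $ p)
        = (\<Sum>j\<in>UNIV. \<Sum>b\<in>UNIV. (if i = j then J_matrix $ a $ b * h $ (i, b) else 0))"
      unfolding sum.cartesian_product UNIV_Times_UNIV
      by (rule sum.cong) (auto simp: K_matrix_def kronecker_def mat_def)
    also have "\<dots> = (\<Sum>b\<in>UNIV. J_matrix $ a $ b * h $ (i, b))"
      by (subst sum.swap) simp
    finally show ?thesis .
  qed
  then show ?thesis
    by (simp add: vortex_def matrix_vector_mult_def vec_eq_iff)
qed

section \<open>Gradients and Hessians as derivatives, and differences of vortex positions\<close>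

lemma gradient_eqI:
  assumes "GDERIV f x :> D"
  shows "gradient f x = D"
  unfolding gradient_def
proof (rule the_equality)
  fix D' assume "GDERIV f x :> D'"
  with assms have "(\<lambda>h. inner h D') = (\<lambda>h. inner h D)"
    unfolding gderiv_def by (rule has_derivative_unique[rotated])
  then show "D' = D"
    by (simp add: fun_eq_iff vector_eq_ldot)
qed (fact assms)

text \<open>This replaces the matrix \<open>hessian\<close> by a derivative computed as a linear
  map, so that no second partial derivatives have to be written out.\<close>

lemma hessian_mult_vec:
  assumes "(gradient f has_derivative L) (at x)"
  shows "hessian f x *v h = L h"
proof -
  have "(gradient f has_derivative (\<lambda>h. hessian f x *v h)) (at x)"
    using differentiableI[OF assms] by (simp add: jacobian_works hessian_def)
  then show ?thesis
    using has_derivative_unique[OF _ assms] by metis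
qed

text \<open>As a linear map of the configuration, it presents each summand of the Hamiltonian as a
  function on the plane pulled back linearly; the chain rule then brings in its adjoint.\<close>

definition separation :: "'n \<Rightarrow> 'n \<Rightarrow> 'n::finite config \<Rightarrow> real^2" where
  "separation i j z = vortex z i - vortex z j"

lemma linear_separation: "linear (separation i j)"
  by (rule linearI) (simp_all add: separation_def vortex_def vec_eq_iff right_diff_distrib)

lemma bounded_linear_separation: "bounded_linear (separation i j)"
  using linear_separation by (simp add: linear_conv_bounded_linear)

lemma separation_K_matrix: "separation i j (K_matrix *v h) = J_matrix *v separation i j h"
  by (simp add: separation_def vortex_K_matrix matrix_vector_mult_diff_distrib)

lemma linear_adjoint_separation: "linear (adjoint (separation i j))"
  by (rule adjoint_linear[OF linear_separation])

lemma bounded_linear_adjoint_separation: "bounded_linear (adjoint (separation i j))"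
  using linear_adjoint_separation by (simp add: linear_conv_bounded_linear)

lemma matrix_vector_mult_minus_left: "(- A) *v x = - (A *v x)" for A :: "'a::ring_1^'n^'m"
  by (simp add: matrix_vector_mult_def vec_eq_iff flip: sum_negf)

text \<open>This is the adjoint of \<open>separation_K_matrix\<close>; the two signs from the skew
  symmetry of \<open>J_matrix\<close> and \<open>K_matrix\<close> cancel.\<close>

lemma adjoint_separation_J_matrix:
  "adjoint (separation i j) (J_matrix *v w) = K_matrix *v adjoint (separation i j) w"
proof (subst vector_eq_ldot[symmetric], rule allI)
  fix h
  have "h \<bullet> adjoint (separation i j) (J_matrix *v w) = separation i j h \<bullet> (J_matrix *v w)"
    by (rule adjoint_works[OF linear_separation])
  also have "\<dots> = (transpose J_matrix *v separation i j h) \<bullet> w"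
    by (simp add: dot_lmul_matrix transpose_matrix_vector)
  also have "\<dots> = separation i j (transpose K_matrix *v h) \<bullet> w"
    by (simp add: transpose_J_matrix transpose_K_matrix matrix_vector_mult_minus_left linear_neg[OF linear_separation] separation_K_matrix)
  also have "\<dots> = (transpose K_matrix *v h) \<bullet> adjoint (separation i j) w"
    by (simp add: adjoint_works[OF linear_separation])
  also have "\<dots> = h \<bullet> (K_matrix *v adjoint (separation i j) w)"
    by (simp add: dot_lmul_matrix transpose_matrix_vector)
  finally show "h \<bullet> adjoint (separation i j) (J_matrix *v w) = h \<bullet> (K_matrix *v adjoint (separation i j) w)" .
qed

lemma open_collision_free: "open (collision_free :: 'n::finite config set)"
proof -
  have "collision_free = (\<Inter>p\<in>{p :: 'n \<times> 'n. fst p \<noteq> snd p}. {z. separation (fst p) (snd p) z \<noteq> 0})"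
    by (auto simp: collision_free_def separation_def)
  moreover have "open \<dots>"
    by (intro open_INT ballI open_Collect_neq linear_continuous_on bounded_linear_separation continuous_on_const) auto
  ultimately show ?thesis by simp
qed

section \<open>First and second derivatives of the logarithmic interaction\<close>

lemma GDERIV_ln_norm_separation:
  assumes "separation i j z \<noteq> 0"
  shows "GDERIV (\<lambda>z. ln (norm (separation i j z))) z
    :> adjoint (separation i j) (separation i j z /\<^sub>R (norm (separation i j z))\<^sup>2)"
proof -
  let ?s = "separation i j"
  have d: "(?s has_derivative ?s) (at z)"
    by (rule bounded_linear_imp_has_derivative[OF bounded_linear_separation])
  have "((\<lambda>z. norm (?s z)) has_derivative (\<lambda>h. ?s h \<bullet> sgn (?s z))) (at z)"
    using has_derivative_compose[OF d has_derivative_norm[OF assms]] by simp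
  from has_derivative_ln[OF _ this]
  have "((\<lambda>z. ln (norm (?s z))) has_derivative (\<lambda>h. ?s h \<bullet> sgn (?s z) * inverse (norm (?s z)))) (at z)"
    using assms by simp
  moreover have "?s h \<bullet> sgn (?s z) * inverse (norm (?s z)) = h \<bullet> adjoint ?s (?s z /\<^sub>R (norm (?s z))\<^sup>2)" for h
    by (simp add: adjoint_works[OF linear_separation] sgn_div_norm power2_eq_square)
  ultimately show ?thesis
    by (simp add: gderiv_def)
qed

text \<open>The derivative at \<open>w\<close>, in direction \<open>v\<close>, of the inversion
  \<open>w / |w|^2\<close>. As the inversion is the gradient of \<open>log |w|\<close>, this is the
  Hessian of the logarithm.\<close>

definition inversion_deriv :: "'a::real_inner \<Rightarrow> 'a \<Rightarrow> 'a" where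
  "inversion_deriv w v = v /\<^sub>R (norm w)\<^sup>2 - (2 * (w \<bullet> v) / (norm w) ^ 4) *\<^sub>R w"

lemma has_derivative_inversion:
  fixes w :: "'a::real_inner"
  assumes "w \<noteq> 0"
  shows "((\<lambda>w. w /\<^sub>R (norm w)\<^sup>2) has_derivative inversion_deriv w) (at w)"
proof -
  have 4: "(norm w) ^ 4 = (w \<bullet> w)\<^sup>2"
    by (simp only: power2_norm_eq_inner[symmetric] power_mult[symmetric]) simp
  have sq: "((\<lambda>w. w \<bullet> w) has_derivative (\<lambda>v. w \<bullet> v + v \<bullet> w)) (at w)"
    by (rule has_derivative_inner[OF has_derivative_ident has_derivative_ident])
  have "w \<bullet> w \<noteq> 0"
    using assms by simp
  from has_derivative_scaleR[OF Deriv.has_derivative_inverse[OF this sq] has_derivative_ident]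
  have "((\<lambda>w. w /\<^sub>R (w \<bullet> w)) has_derivative (\<lambda>v. inverse (w \<bullet> w) *\<^sub>R v +
      (- (inverse (w \<bullet> w) * (w \<bullet> v + v \<bullet> w) * inverse (w \<bullet> w))) *\<^sub>R w)) (at w)" .
  moreover have "inverse (w \<bullet> w) *\<^sub>R v + (- (inverse (w \<bullet> w) * (w \<bullet> v + v \<bullet> w) * inverse (w \<bullet> w))) *\<^sub>R w
      = inversion_deriv w v" for v
    unfolding inversion_deriv_def 4 power2_norm_eq_inner inner_commute[of v]
    by (simp add: power2_eq_square divide_inverse)
  ultimately show ?thesis by (simp add: power2_norm_eq_inner)
qed

text \<open>Harmonicity of the logarithm enters here. In complex notation the inversion is the
  reciprocal of the conjugate of \<open>w\<close>, so its derivative is conjugate-linear, while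
  \<open>J_matrix\<close> is multiplication by \<open>-i\<close>. At \<open>w = 0\<close> both sides
  are 0 by the convention for division.\<close>

lemma inversion_deriv_J_matrix:
  "inversion_deriv w (J_matrix *v v) = - (J_matrix *v inversion_deriv w v)"
proof (cases "w = 0")
  case False
  define a b c d q where abcd: "a = w $ 1" "b = w $ 2" "c = v $ 1" "d = v $ 2" "q = w \<bullet> w"
  have q: "q = a * a + b * b" "q \<noteq> 0"
    using False by (simp_all add: abcd) (simp add: inner_vec_def sum_2)
  \<comment> \<open>Over the common denominator \<open>q^2\<close>, each coordinate becomes a
    polynomial identity once \<open>q\<close> is expanded in the numerators.\<close>
  have *: "e / q = (e * q) / q\<^sup>2" for e
    using q(2) by (simp add: power2_eq_square)
  have "d / q - 2 * (a * d - b * c) / q\<^sup>2 * a = - (d / q - 2 * (a * c + b * d) / q\<^sup>2 * b)"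
    unfolding *[of d] times_divide_eq_left diff_divide_distrib[symmetric] minus_divide_left
    by (rule arg_cong[of _ _ "\<lambda>x. x / q\<^sup>2"], unfold q(1)) (simp add: algebra_simps)
  moreover have "- c / q - 2 * (a * d - b * c) / q\<^sup>2 * b = c / q - 2 * (a * c + b * d) / q\<^sup>2 * a"
    unfolding *[of c] *[of "- c"] times_divide_eq_left diff_divide_distrib[symmetric]
    by (rule arg_cong[of _ _ "\<lambda>x. x / q\<^sup>2"], unfold q(1)) (simp add: algebra_simps)
  moreover have "w \<bullet> v = a * c + b * d" "w \<bullet> vector [d, - c] = a * d - b * c"
    by (simp_all add: inner_vec_def sum_2 abcd)
  moreover have "(norm w)\<^sup>2 = q" "(norm w) ^ 4 = q\<^sup>2"
    by (simp_all only: abcd power2_norm_eq_inner[symmetric] power_mult[symmetric]) simp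
  ultimately show ?thesis
    unfolding inversion_deriv_def J_matrix_vec
    by (simp only: vec_eq_iff forall_2 vector_2 vector_minus_component vector_uminus_component vector_scaleR_component
        real_scaleR_def abcd[symmetric] divide_inverse_commute[symmetric] minus_minus simp_thms)
qed (simp add: inversion_deriv_def)

text \<open>A closed formula that can be differentiated termwise, unlike the definite description
  behind \<open>gradient\<close>; the two agree on \<open>collision_free\<close>.\<close>

definition hamiltonian_gradient ::
    "('n \<Rightarrow> real) \<Rightarrow> 'n::{finite,linorder} config \<Rightarrow> 'n config" where
  "hamiltonian_gradient \<Gamma> z = - (\<Sum>(i, j)\<in>{(i, j). i < j}.
     (\<Gamma> i * \<Gamma> j) *\<^sub>R adjoint (separation i j) (separation i j z /\<^sub>R (norm (separation i j z))\<^sup>2))"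

definition hamiltonian_hessian ::
    "('n \<Rightarrow> real) \<Rightarrow> 'n::{finite,linorder} config \<Rightarrow> 'n config \<Rightarrow> 'n config" where
  "hamiltonian_hessian \<Gamma> z h = - (\<Sum>(i, j)\<in>{(i, j). i < j}.
     (\<Gamma> i * \<Gamma> j) *\<^sub>R adjoint (separation i j) (inversion_deriv (separation i j z) (separation i j h)))"

lemma separation_nonzero: "z \<in> collision_free \<Longrightarrow> i \<noteq> j \<Longrightarrow> separation i j z \<noteq> 0"
  by (simp add: collision_free_def separation_def)

lemma gradient_hamiltonian:
  assumes "z \<in> collision_free"
  shows "gradient (hamiltonian \<Gamma>) z = hamiltonian_gradient \<Gamma> z"
proof (rule gradient_eqI)
  have "((\<lambda>z. ln (norm (separation i j z))) has_derivative
      (\<lambda>h. h \<bullet> adjoint (separation i j) (separation i j z /\<^sub>R (norm (separation i j z))\<^sup>2))) (at z)"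
    if "i < j" for i j
    using GDERIV_ln_norm_separation[OF separation_nonzero[OF assms, of i j]] that by (simp add: gderiv_def)
  then have "((\<lambda>z. - (\<Sum>p | fst p < snd p. \<Gamma> (fst p) * \<Gamma> (snd p) * ln (norm (separation (fst p) (snd p) z))))
      has_derivative (\<lambda>h. - (\<Sum>p | fst p < snd p. \<Gamma> (fst p) * \<Gamma> (snd p) *
        (h \<bullet> adjoint (separation (fst p) (snd p)) (separation (fst p) (snd p) z /\<^sub>R (norm (separation (fst p) (snd p) z))\<^sup>2))))) (at z)"
    by (intro has_derivative_minus has_derivative_sum has_derivative_mult_right) auto
  then show "GDERIV (hamiltonian \<Gamma>) z :> hamiltonian_gradient \<Gamma> z"
    by (simp add: gderiv_def hamiltonian_def[abs_def] hamiltonian_gradient_def separation_def[symmetric]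
        case_prod_unfold inner_sum_right)
qed

lemma has_derivative_hamiltonian_gradient:
  assumes "z \<in> collision_free"
  shows "(hamiltonian_gradient \<Gamma> has_derivative hamiltonian_hessian \<Gamma> z) (at z)"
proof -
  have "((\<lambda>z. adjoint (separation i j) (separation i j z /\<^sub>R (norm (separation i j z))\<^sup>2)) has_derivative
      (\<lambda>h. adjoint (separation i j) (inversion_deriv (separation i j z) (separation i j h)))) (at z)"
    if "i < j" for i j
    using that separation_nonzero[OF assms, of i j]
    by (intro bounded_linear.has_derivative[OF bounded_linear_adjoint_separation]
        has_derivative_compose[OF _ has_derivative_inversion]
        bounded_linear_imp_has_derivative[OF bounded_linear_separation]) auto
  then show ?thesis
    unfolding hamiltonian_gradient_def[abs_def] hamiltonian_hessian_def[abs_def] case_prod_unfold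
    by (intro has_derivative_minus has_derivative_sum has_derivative_scaleR_right) auto
qed

lemma hessian_hamiltonian_mult_vec:
  assumes "z \<in> collision_free"
  shows "hessian (hamiltonian \<Gamma>) z *v h = hamiltonian_hessian \<Gamma> z h"
proof (rule hessian_mult_vec)
  \<comment> \<open>The derivative passes from the closed formula to \<open>gradient\<close> because
    the two agree on an open neighbourhood of \<open>z\<close>.\<close>
  show "(gradient (hamiltonian \<Gamma>) has_derivative hamiltonian_hessian \<Gamma> z) (at z)"
    by (rule has_derivative_transform_within_open
        [OF has_derivative_hamiltonian_gradient[OF assms] open_collision_free assms])
      (simp add: gradient_hamiltonian)
qed

text \<open>Each summand has the form \<open>S* D S\<close> with \<open>S = separation i j\<close>.
  The relations \<open>S K = J S\<close>, \<open>D J = - J D\<close> and \<open>S* J = K S*\<close>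
  carry \<open>K\<close> across it with exactly one change of sign.\<close>

lemma K_matrix_hessian_hamiltonian:
  assumes "z \<in> collision_free"
  shows "K_matrix ** hessian (hamiltonian \<Gamma>) z = - (hessian (hamiltonian \<Gamma>) z ** K_matrix)"
proof -
  have "hamiltonian_hessian \<Gamma> z (K_matrix *v h) = - (K_matrix *v hamiltonian_hessian \<Gamma> z h)" for h
    unfolding hamiltonian_hessian_def case_prod_unfold
    by (simp add: separation_K_matrix inversion_deriv_J_matrix linear_neg[OF linear_adjoint_separation]
        adjoint_separation_J_matrix linear_neg[OF matrix_vector_mul_linear]
        linear_sum[OF matrix_vector_mul_linear] linear_cmul[OF matrix_vector_mul_linear] sum_negf)
  then have "(K_matrix ** hessian (hamiltonian \<Gamma>) z) *v h = (- (hessian (hamiltonian \<Gamma>) z ** K_matrix)) *v h" for h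
    by (simp add: hessian_hamiltonian_mult_vec[OF assms] matrix_vector_mult_minus_left flip: matrix_vector_mul_assoc)
  then show ?thesis
    by (simp add: matrix_eq)
qed

lemma K_matrix_scaled_hessian:
  fixes \<Gamma> :: "'n::{finite,linorder} \<Rightarrow> real"
  assumes "\<And>i. \<Gamma> i \<noteq> 0" "\<xi> \<in> collision_free"
  shows "K_matrix ** scaled_hessian \<Gamma> \<xi> = - (scaled_hessian \<Gamma> \<xi> ** K_matrix)"
proof -
  let ?M = "circulation_matrix (\<lambda>i. 1 / \<Gamma> i)" and ?H = "hessian (hamiltonian \<Gamma>) \<xi>"
  have "K_matrix ** (?M ** ?H) = ?M ** (K_matrix ** ?H)"
    by (simp add: matrix_mul_assoc K_matrix_circulation_matrix)
  also have "\<dots> = - (?M ** ?H ** K_matrix)"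
    by (simp add: K_matrix_hessian_hamiltonian[OF assms(2)] matrix_mul_minus_right matrix_mul_assoc)
  finally show ?thesis
    by (simp add: scaled_hessian_def matrix_inv_circulation_matrix[OF assms(1)])
qed

section \<open>Multiplicity counts and the stability criterion\<close>

lemma eigenvalue_iff_mem: "eigenvalue A l \<longleftrightarrow> l \<in># eigenvalues A"
  by (simp add: eigenvalue_iff_root eigenvalues_def charpoly_nonzero)

theorem theorem1:
  fixes \<Gamma> :: "'n::{finite,linorder} \<Rightarrow> real"
    and \<omega> :: real
    and \<xi> :: "'n config"
    and z :: "real \<Rightarrow> 'n config"
  assumes "CARD('n) \<ge> 2"
    and "\<And>i. \<Gamma> i \<noteq> 0"
    and "(\<Sum>i\<in>UNIV. \<Gamma> i) \<noteq> 0"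
    and "central_configuration \<Gamma> \<omega> \<xi>"
    and "\<omega> \<noteq> 0"
    and "z = relative_equilibrium \<omega> \<xi>"
  shows "(nondegenerate \<Gamma> \<omega> z \<longrightarrow>
            (spectrally_stable \<Gamma> \<omega> z \<longleftrightarrow>
              (\<forall>\<mu>. eigenvalue (scaled_hessian \<Gamma> \<xi>) \<mu> \<longrightarrow>
                 Re \<mu> = 0 \<or> \<mu> \<in> \<real> \<and> Re \<mu> \<in> {- \<bar>\<omega>\<bar>..\<bar>\<omega>\<bar>}))) \<and>
         (nondegenerate \<Gamma> \<omega> z \<longleftrightarrow>
            (\<forall>\<mu>\<in>#nontrivial_hessian_eigenvalues \<Gamma> \<omega> \<xi>.
               \<mu> \<noteq> of_real \<omega> \<and> \<mu> \<noteq> - of_real \<omega>))"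
proof -
  let ?A = "scaled_hessian \<Gamma> \<xi>" and ?B = "stability_matrix \<Gamma> \<omega> \<xi>" and ?w = "complex_of_real \<omega>"
  let ?T = "{#0, 0, \<i> * ?w, - \<i> * ?w#}"
  have z: "z 0 = \<xi>"
    using assms(6) by (simp add: relative_equilibrium_0)
  have "\<xi> \<in> collision_free"
    using assms(4) by (simp add: central_configuration_def)
  \<comment> \<open>The chained facts discharge the assumptions on \<open>K\<close>,
    \<open>A\<close>, \<open>w\<close> and \<open>B\<close>; \<open>stability_matrix_def\<close> is
    the equation for \<open>B\<close>.\<close>
  from K_matrix_square K_matrix_scaled_hessian[OF assms(2) this] assms(5) stability_matrix_def
  have orders: "order 0 (charpoly (complexify ?B)) = 2 * order ?w (charpoly (complexify ?A))"
      "order (- ?w) (charpoly (complexify ?A)) = order ?w (charpoly (complexify ?A))"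
    and imaginary: "(\<forall>l. eigenvalue ?B l \<longrightarrow> Re l = 0) \<longleftrightarrow>
      (\<forall>m. eigenvalue ?A m \<longrightarrow> Re m = 0 \<or> m \<in> \<real> \<and> Re m \<in> {- \<bar>\<omega>\<bar>..\<bar>\<omega>\<bar>})"
    by (rule order_charpoly_stability all_stability_eigenvalues_imaginary_iff)+
  have "nondegenerate \<Gamma> \<omega> z \<longleftrightarrow> count (nontrivial_stability_eigenvalues \<Gamma> \<omega> \<xi>) 0 = 0"
    unfolding nondegenerate_def z by (metis not_in_iff)
  \<comment> \<open>Let \<open>k\<close> be the multiplicity of \<omega> for \<open>?A\<close>. As
    \<omega> is nonzero, exactly two zeros are subtracted from the \<open>2 k\<close> zeros of
    \<open>?B\<close>, so none is left iff \<open>k\<close> is at most 1.\<close>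
  also have "\<dots> \<longleftrightarrow> order ?w (charpoly (complexify ?A)) \<le> 1"
    using assms(5) by (auto simp: nontrivial_stability_eigenvalues_def count_eigenvalues orders)
  \<comment> \<open>Both counts are the truncated difference \<open>k - 1\<close>, because \<omega>
    and its negative have the same multiplicity.\<close>
  also have "\<dots> \<longleftrightarrow> count (nontrivial_hessian_eigenvalues \<Gamma> \<omega> \<xi>) ?w = 0 \<and>
      count (nontrivial_hessian_eigenvalues \<Gamma> \<omega> \<xi>) (- ?w) = 0"
    using assms(5) by (simp add: nontrivial_hessian_eigenvalues_def count_eigenvalues orders)
  also have "\<dots> \<longleftrightarrow> (\<forall>\<mu>\<in>#nontrivial_hessian_eigenvalues \<Gamma> \<omega> \<xi>. \<mu> \<noteq> ?w \<and> \<mu> \<noteq> - ?w)"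
    by (metis not_in_iff)
  finally have nondegenerate: "nondegenerate \<Gamma> \<omega> z \<longleftrightarrow>
      (\<forall>\<mu>\<in>#nontrivial_hessian_eigenvalues \<Gamma> \<omega> \<xi>. \<mu> \<noteq> ?w \<and> \<mu> \<noteq> - ?w)" .
  \<comment> \<open>All members of \<open>?T\<close> are purely imaginary, so removing them does not
    affect the condition.\<close>
  have "(\<forall>l\<in>#eigenvalues ?B - ?T. Re l = 0) \<longleftrightarrow> (\<forall>l. eigenvalue ?B l \<longrightarrow> Re l = 0)"
  proof (intro iffI allI impI ballI)
    fix l assume *: "\<forall>l\<in>#eigenvalues ?B - ?T. Re l = 0" and l: "eigenvalue ?B l"
    show "Re l = 0"
    proof (cases "l \<in># ?T")
      case True
      then show ?thesis by auto
    next
      case False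
      then have "l \<in># eigenvalues ?B - ?T"
        using l by (simp only: eigenvalue_iff_mem in_diff_count not_in_iff count_greater_zero_iff)
      with * show ?thesis by blast
    qed
  next
    fix l assume *: "\<forall>l. eigenvalue ?B l \<longrightarrow> Re l = 0" and l: "l \<in># eigenvalues ?B - ?T"
    have "eigenvalue ?B l"
      unfolding eigenvalue_iff_mem using l by (rule in_diffD)
    with * show "Re l = 0" by simp
  qed
  with imaginary have stable: "spectrally_stable \<Gamma> \<omega> z \<longleftrightarrow> nondegenerate \<Gamma> \<omega> z \<and>
      (\<forall>\<mu>. eigenvalue ?A \<mu> \<longrightarrow> Re \<mu> = 0 \<or> \<mu> \<in> \<real> \<and> Re \<mu> \<in> {- \<bar>\<omega>\<bar>..\<bar>\<omega>\<bar>})"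
    by (simp only: spectrally_stable_def z nontrivial_stability_eigenvalues_def simp_thms)
  show ?thesis
  proof (intro conjI impI)
    assume "nondegenerate \<Gamma> \<omega> z"
    with stable show "spectrally_stable \<Gamma> \<omega> z \<longleftrightarrow>
        (\<forall>\<mu>. eigenvalue ?A \<mu> \<longrightarrow> Re \<mu> = 0 \<or> \<mu> \<in> \<real> \<and> Re \<mu> \<in> {- \<bar>\<omega>\<bar>..\<bar>\<omega>\<bar>})"
      by (simp only: simp_thms)
  qed (rule nondegenerate)
qed

end
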